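(* Let $A,B,C\subset\mathbb{R}^2$ be convex bodies. Then $$|A|^{1/2}\,|A+B+C|^{1/2}+|B|^{1/2}\,|C|^{1/2}\le|A+B|^{1/2}\,|A+C|^{1/2}.$$
   Context: A convex body is a compact convex set with non-empty interior. $|\cdot|$ is the area (2-dimensional Lebesgue measure) and $+$ is Minkowski sum. *)

theory Defs
  imports "HOL-Analysis.Analysis" "HOL-Library.Set_Algebras"
begin

definition convex_body :: "'a::euclidean_space set \<Rightarrow> bool" where
  "convex_body K \<longleftrightarrow> convex K \<and> compact K \<and> interior K \<noteq> {}"

end

theory Submission
  imports Defs
begin

text \<open>
  Area is a quadratic form on the cone generated by \<open>A\<close>, \<open>B\<close>, \<open>C\<close> under Minkowski addition: a body is
  exhausted by inscribed polygons whose vertices are its points of contact with supporting lines of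
  prescribed slopes, contact points can be chosen additively, and the area under such a polygon is a
  sum of trapezoids, quadratic in its vertices. Brunn--Minkowski makes this form Lorentzian, so that
  the mixed areas satisfy \<open>(V(A,B) V(A,C) - |A| V(B,C))\<^sup>2 \<le> (V(A,B)\<^sup>2 - |A| |B|) (V(A,C)\<^sup>2 - |A| |C|)\<close>.
  Hence, for fixed other quantities, \<open>|A + B + C|\<close> is largest in the case of signature \<open>(1, 1)\<close>. There the
  form is a product of two linear null coordinates, and the claim is the Cauchy--Schwarz inequality
  combined with the identity \<open>a (a + b + c) + b c = (a + b) (a + c)\<close> in each coordinate.
\<close>

section \<open>Convex bodies and their upper boundaries\<close>

definition body :: "'a::euclidean_space set \<Rightarrow> bool" where
  "body K \<longleftrightarrow> convex K \<and> compact K \<and> K \<noteq> {}"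

lemma body_plus:
  assumes "body A" "body B"
  shows "body (A + B)"
proof -
  have "A + B = {x + y |x y. x \<in> A \<and> y \<in> B}"
    by (auto simp: set_plus_def)
  then have "compact (A + B)"
    using assms compact_sums[of A B] by (simp add: body_def)
  moreover have "convex (A + B)"
    using assms by (simp add: body_def convex_set_plus)
  moreover have "A + B \<noteq> {}"
    using assms by (auto simp: body_def set_plus_def)
  ultimately show ?thesis by (simp add: body_def)
qed

lemma body_linear_image:
  fixes f :: "'a::euclidean_space \<Rightarrow> 'b::euclidean_space"
  assumes "linear f" "body A"
  shows "body (f ` A)"
  using assms
  by (auto simp: body_def linear_conv_bounded_linear
      intro!: compact_continuous_image convex_linear_image linear_continuous_on)

lemma linear_image_plus:
  assumes "linear f"
  shows "f ` (A + B) = f ` A + f ` B"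
proof -
  have "f ` (A + B) = (\<lambda>(x, y). f x + f y) ` (A \<times> B)"
    by (simp add: set_plus_image image_image case_prod_unfold linear_add[OF assms])
  also have "\<dots> = f ` A + f ` B"
    by (force simp: set_plus_image)
  finally show ?thesis .
qed

lemma body_scaleR: "body A \<Longrightarrow> body ((*\<^sub>R) r ` A)"
  by (rule body_linear_image) auto

text \<open>On the projection of a body this is a concave function. Elsewhere it is the supremum of
  the empty set and carries no meaning, so later statements stay on the projection.\<close>

definition upper :: "(real \<times> real) set \<Rightarrow> real \<Rightarrow> real" where
  "upper A x = Sup {y. (x, y) \<in> A}"

lemma vertical_slice_compact:
  assumes "body A"
  shows "compact {y. (x, y) \<in> A}"
proof -
  have "compact (A \<inter> {x} \<times> UNIV)"
    using assms by (intro compact_Int_closed closed_Times) (auto simp: body_def)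
  then have "compact (snd ` (A \<inter> {x} \<times> UNIV))"
    by (intro compact_continuous_image continuous_intros)
  also have "snd ` (A \<inter> {x} \<times> UNIV) = {y. (x, y) \<in> A}"
    by force
  finally show ?thesis .
qed

lemma upper_mem:
  assumes "body A" "x \<in> fst ` A"
  shows "(x, upper A x) \<in> A"
proof -
  have "{y. (x, y) \<in> A} \<noteq> {}" using assms(2) by force
  moreover have c: "compact {y. (x, y) \<in> A}" using assms(1) by (rule vertical_slice_compact)
  ultimately have "Sup {y. (x, y) \<in> A} \<in> {y. (x, y) \<in> A}"
    by (intro closed_contains_Sup compact_imp_closed bounded_imp_bdd_above compact_imp_bounded)
  then show ?thesis by (simp add: upper_def)
qed

lemma upper_ge:
  assumes "body A" "(x, y) \<in> A"
  shows "y \<le> upper A x"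
  unfolding upper_def
  using assms vertical_slice_compact[of A x]
  by (intro cSup_upper bounded_imp_bdd_above compact_imp_bounded) auto

lemma body_fst_interval:
  fixes A :: "(real \<times> real) set"
  assumes "body A"
  obtains a b where "a \<le> b" "fst ` A = {a..b}"
proof -
  have "body (fst ` A)" using assms by (intro body_linear_image linear_fst)
  then obtain a b where "fst ` A = {a..b}" "fst ` A \<noteq> {}"
    by (metis body_def connected_compact_interval_1 connected_convex_1)
  then show ?thesis using that by auto
qed

lemma upper_concave:
  assumes "body A" "x \<in> fst ` A" "y \<in> fst ` A" "0 \<le> u" "0 \<le> v" "u + v = 1"
  shows "u * x + v * y \<in> fst ` A" "u * upper A x + v * upper A y \<le> upper A (u * x + v * y)"
proof -
  have "u *\<^sub>R (x, upper A x) + v *\<^sub>R (y, upper A y) \<in> A"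
    using assms upper_mem[of A] by (intro convexD) (auto simp: body_def)
  then have *: "(u * x + v * y, u * upper A x + v * upper A y) \<in> A" by simp
  then show "u * x + v * y \<in> fst ` A" by force
  show "u * upper A x + v * upper A y \<le> upper A (u * x + v * y)"
    using * assms(1) upper_ge by blast
qed

lemma upper_superadditive:
  assumes "body A" "body B" "x \<in> fst ` A" "y \<in> fst ` B"
  shows "x + y \<in> fst ` (A + B)" "upper A x + upper B y \<le> upper (A + B) (x + y)"
proof -
  have "(x, upper A x) + (y, upper B y) \<in> A + B"
    using assms upper_mem by (intro set_plus_intro) auto
  then have *: "(x + y, upper A x + upper B y) \<in> A + B" by simp
  then show "x + y \<in> fst ` (A + B)" by force
  show "upper A x + upper B y \<le> upper (A + B) (x + y)"
    using * body_plus[OF assms(1,2)] upper_ge by blast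
qed

lemma body_bounds:
  fixes A :: "(real \<times> real) set"
  assumes "body A"
  obtains R where "R > 0" "\<And>x y. (x, y) \<in> A \<Longrightarrow> \<bar>x\<bar> \<le> R \<and> \<bar>y\<bar> \<le> R"
proof -
  obtain R where "R > 0" and R: "\<And>z. z \<in> A \<Longrightarrow> norm z \<le> R"
    using assms bounded_pos[of A] by (auto simp: body_def compact_imp_bounded)
  have "\<bar>x\<bar> \<le> R \<and> \<bar>y\<bar> \<le> R" if "(x, y) \<in> A" for x y
    using R[OF that] norm_fst_le[of x y] norm_snd_le[of y x] by simp
  then show ?thesis using \<open>R > 0\<close> that by blast
qed

text \<open>Concavity gives continuity on the open interval; with boundedness this yields
  integrability there, and the two endpoints do not affect the integral.\<close>

lemma upper_integrable:
  assumes "body A" "fst ` A = {a..b}"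
  shows "upper A integrable_on {a..b}"
proof -
  have "convex_on {a<..<b} (\<lambda>x. - upper A x)"
  proof (rule convex_onI)
    fix t x y :: real
    assume t: "0 < t" "t < 1" and "x \<in> {a<..<b}" "y \<in> {a<..<b}"
    then show "- upper A ((1 - t) *\<^sub>R x + t *\<^sub>R y) \<le> (1 - t) * - upper A x + t * - upper A y"
      using upper_concave(2)[OF assms(1), of x y "1 - t" t] assms(2) by auto
  qed auto
  then have "continuous_on {a<..<b} (\<lambda>x. - (- upper A x))"
    by (intro continuous_on_minus convex_on_continuous) auto
  then have c: "continuous_on {a<..<b} (upper A)" by simp
  obtain R where R: "R > 0" "\<And>x y. (x, y) \<in> A \<Longrightarrow> \<bar>x\<bar> \<le> R \<and> \<bar>y\<bar> \<le> R"
    using body_bounds[OF assms(1)] by blast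
  have "upper A integrable_on {a<..<b}"
  proof (rule measurable_bounded_by_integrable_imp_integrable)
    show "upper A \<in> borel_measurable (lebesgue_on {a<..<b})"
      using c by (intro continuous_imp_measurable_on_sets_lebesgue) auto
    show "(\<lambda>x. R) integrable_on {a<..<b}"
      using integrable_on_Icc_iff_Ioo[of "\<lambda>x. R" a b] by auto
    show "norm (upper A x) \<le> R" if "x \<in> {a<..<b}" for x
      using R(2) upper_mem[OF assms(1), of x] assms(2) that by auto
  qed auto
  then show ?thesis by (simp add: integrable_on_Icc_iff_Ioo)
qed

section \<open>Inscribed polygons\<close>

text \<open>\<open>z\<close> is a point of contact with a line of slope \<open>p\<close> that bounds
  \<open>A\<close> from above. If the boundary contains a segment of that slope, there are many such
  points, so contact points have to be chosen.\<close>

definition supports :: "(real \<times> real) set \<Rightarrow> real \<Rightarrow> real \<times> real \<Rightarrow> bool" where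
  "supports A p z \<longleftrightarrow> z \<in> A \<and> (\<forall>w\<in>A. snd w - p * fst w \<le> snd z - p * fst z)"

lemma supports_exists:
  assumes "body A"
  shows "\<exists>z. supports A p z"
proof -
  have "\<exists>z\<in>A. \<forall>w\<in>A. snd w - p * fst w \<le> snd z - p * fst z"
    using assms by (intro continuous_attains_sup continuous_intros) (auto simp: body_def)
  then show ?thesis unfolding supports_def by blast
qed

text \<open>A linear functional is maximised over a Minkowski sum by maximising it over each
  summand. This makes the vertices of the inscribed polygons additive.\<close>

lemma supports_plus:
  assumes "supports A p z" "supports B p w"
  shows "supports (A + B) p (z + w)"
proof -
  have "snd (x + y) - p * fst (x + y) \<le> snd (z + w) - p * fst (z + w)" if "x \<in> A" "y \<in> B" for x y
  proof -
    have "snd x - p * fst x \<le> snd z - p * fst z" "snd y - p * fst y \<le> snd w - p * fst w"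
      using assms that by (auto simp: supports_def)
    then show ?thesis by (simp add: algebra_simps)
  qed
  then show ?thesis
    using assms by (auto simp: supports_def set_plus_def)
qed

lemma supports_scaleR:
  assumes "supports A p z" "0 \<le> r"
  shows "supports ((*\<^sub>R) r ` A) p (r *\<^sub>R z)"
proof -
  have "r * snd x - p * (r * fst x) \<le> r * snd z - p * (r * fst z)" if "x \<in> A" for x
  proof -
    have "r * (snd x - p * fst x) \<le> r * (snd z - p * fst z)"
      using assms that by (intro mult_left_mono) (auto simp: supports_def)
    then show ?thesis by (simp add: algebra_simps)
  qed
  then show ?thesis using assms by (auto simp: supports_def)
qed

lemma supports_snd:
  assumes "body A" "supports A p z"
  shows "upper A (fst z) = snd z"
proof (rule antisym)
  have z: "(fst z, snd z) \<in> A" using assms(2) by (simp add: supports_def)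
  then have "(fst z, upper A (fst z)) \<in> A" using assms(1) by (intro upper_mem) force+
  then show "upper A (fst z) \<le> snd z" using assms(2) by (force simp: supports_def)
  show "snd z \<le> upper A (fst z)" using z assms(1) by (rule upper_ge[rotated])
qed

text \<open>The signed area between the chord from \<open>z\<close> to \<open>w\<close> and the
  horizontal axis, a quadratic polynomial in the four coordinates.\<close>

definition trapezoid :: "real \<times> real \<Rightarrow> real \<times> real \<Rightarrow> real" where
  "trapezoid z w = (snd z + snd w) / 2 * (fst w - fst z)"

text \<open>Between the contact points, the boundary lies above the chord and below the supporting
  line at \<open>z\<close>. The chord has slope at least \<open>q\<close>, so the gap at
  \<open>x\<close> is at most \<open>(p - q) * (x - fst z)\<close>.\<close>

lemma trapezoid_approx:
  assumes A: "body A" and ab: "fst ` A = {a..b}"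
    and z: "supports A p z" and w: "supports A q w" and "q < p"
  shows "fst z \<le> fst w"
    "\<bar>integral {fst z..fst w} (upper A) - trapezoid z w\<bar> \<le> (p - q) * (b - a) * (fst w - fst z)"
proof -
  obtain x1 y1 x2 y2 where zw: "z = (x1, y1)" "w = (x2, y2)" by fastforce
  have u: "upper A x1 = y1" "upper A x2 = y2"
    using supports_snd[OF A z] supports_snd[OF A w] zw by auto
  have mem: "(x1, y1) \<in> A" "(x2, y2) \<in> A" using z w zw by (auto simp: supports_def)
  then have dom: "x1 \<in> {a..b}" "x2 \<in> {a..b}" using ab by force+
  have p: "y \<le> y1 + p * (x - x1)" if "(x, y) \<in> A" for x y
    using z that unfolding zw supports_def by (force simp: algebra_simps)
  have q: "y \<le> y2 + q * (x - x2)" if "(x, y) \<in> A" for x y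
    using w that unfolding zw supports_def by (force simp: algebra_simps)
  \<comment> \<open>Each supporting line is tested at the other contact point; adding the two
    inequalities shows that a smaller slope means a contact point further to the right.\<close>
  have "0 \<le> (p - q) * (x2 - x1)"
    using p[OF mem(2)] q[OF mem(1)] by (simp add: algebra_simps)
  then have le: "x1 \<le> x2" using \<open>q < p\<close> by (simp add: zero_le_mult_iff)
  then show "fst z \<le> fst w" by (simp add: zw)
  have "\<bar>integral {x1..x2} (upper A) - trapezoid z w\<bar> \<le> (p - q) * (b - a) * (x2 - x1)"
  proof (cases "x1 = x2")
    case True
    then show ?thesis by (simp add: zw trapezoid_def)
  next
    case False
    define m where "m = (y2 - y1) / (x2 - x1)"
    have m: "m * (x2 - x1) = y2 - y1" using False by (simp add: m_def)
    have "y1 + q * (x2 - x1) \<le> y2" using q[OF mem(1)] by (simp add: algebra_simps)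
    then have "q * (x2 - x1) \<le> m * (x2 - x1)" using m by simp
    then have qm: "q \<le> m" using le False by simp
    define c where "c = (\<lambda>x. y1 + m * (x - x1))"
    define F where "F = (\<lambda>x. y1 * x + m * (x - x1)\<^sup>2 / 2)"
    have "(c has_integral (F x2 - F x1)) {x1..x2}"
      unfolding c_def F_def
      by (intro fundamental_theorem_of_calculus le)
        (auto intro!: derivative_eq_intros simp flip: has_real_derivative_iff_has_vector_derivative)
    moreover have "F x2 - F x1 = trapezoid z w"
    proof -
      have "F x2 - F x1 = y1 * (x2 - x1) + m * (x2 - x1) * (x2 - x1) / 2"
        by (simp add: F_def algebra_simps power2_eq_square)
      also have "\<dots> = trapezoid z w"
        unfolding m by (simp add: zw trapezoid_def field_simps)
      finally show ?thesis .
    qed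
    ultimately have c: "(c has_integral trapezoid z w) {x1..x2}" by simp
    have "upper A integrable_on {x1..x2}"
      using upper_integrable[OF A ab] dom by (rule_tac integrable_subinterval_real) auto
    then have "((\<lambda>x. upper A x - c x) has_integral
        (integral {x1..x2} (upper A) - trapezoid z w)) {x1..x2}"
      using c by (intro has_integral_diff) auto
    then have "norm (integral {x1..x2} (upper A) - trapezoid z w)
        \<le> ((p - q) * (b - a)) * Henstock_Kurzweil_Integration.content {x1..x2}"
    proof (rule has_integral_bound_real[where S="{}", rotated 2])
      fix x assume "x \<in> {x1..x2} - {}"
      then have x: "x \<in> {x1..x2}" by simp
      then have xd: "x \<in> fst ` A" using dom ab by auto
      have "upper A x \<le> y1 + p * (x - x1)" using p upper_mem[OF A xd] by blast
      moreover have "c x \<le> upper A x"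
      proof -
        \<comment> \<open>Barycentric coordinates of \<open>x\<close> in the interval from
          \<open>x1\<close> to \<open>x2\<close>, by which concavity puts the chord below the
          boundary.\<close>
        define u where "u = (x2 - x) / (x2 - x1)"
        define v where "v = (x - x1) / (x2 - x1)"
        have uv: "u + v = 1" "u \<ge> 0" "v \<ge> 0"
          using le False x by (auto simp: u_def v_def simp flip: add_divide_distrib)
        have vx: "v * (x2 - x1) = x - x1" using False by (simp add: v_def)
        have ueq: "u = 1 - v" using uv by simp
        have "u * x1 + v * x2 = x" using vx unfolding ueq by (simp add: algebra_simps)
        then have "u * y1 + v * y2 \<le> upper A x"
          using upper_concave(2)[OF A, of x1 x2 u v] dom ab uv u by auto
        moreover have "u * y1 + v * y2 = y1 + v * (m * (x2 - x1))"
          unfolding m ueq by (simp add: algebra_simps)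
        moreover have "v * (m * (x2 - x1)) = m * (x - x1)"
          unfolding vx[symmetric] by simp
        ultimately show ?thesis by (simp add: c_def)
      qed
      moreover have "y1 + q * (x - x1) \<le> c x"
        using qm x by (simp add: c_def mult_right_mono)
      ultimately have "\<bar>upper A x - c x\<bar> \<le> (p - q) * (x - x1)" by (simp add: algebra_simps)
      also have "\<dots> \<le> (p - q) * (b - a)"
        using \<open>q < p\<close> x dom by (intro mult_left_mono) auto
      finally show "norm (upper A x - c x) \<le> (p - q) * (b - a)" by simp
    qed (use \<open>q < p\<close> dom in auto)
    then show ?thesis using le by simp
  qed
  then show "\<bar>integral {fst z..fst w} (upper A) - trapezoid z w\<bar> \<le> (p - q) * (b - a) * (fst w - fst z)"
    by (simp add: zw)
qed

text \<open>Each step costs \<open>d * (b - a)\<close> times its own width. The widths telescope, so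
  the error stays bounded however many steps are taken.\<close>

lemma trapezoid_sum_approx:
  assumes A: "body A" and ab: "fst ` A = {a..b}" and "0 < d"
    and z: "\<And>k. supports A (p - d * real k) (z k)"
  shows "fst (z 0) \<le> fst (z K) \<and>
    \<bar>integral {fst (z 0)..fst (z K)} (upper A) - (\<Sum>k<K. trapezoid (z k) (z (Suc k)))\<bar>
      \<le> d * (b - a) * (fst (z K) - fst (z 0))"
proof (induction K)
  case 0
  show ?case by simp
next
  case (Suc K)
  have lt: "p - d * real (Suc K) < p - d * real K" using \<open>0 < d\<close> by (simp add: algebra_simps)
  note step = trapezoid_approx[OF A ab z[of K] z[of "Suc K"] lt]
  have dd: "p - d * real K - (p - d * real (Suc K)) = d" by (simp add: algebra_simps)
  have dom: "fst (z k) \<in> {a..b}" for k using z[of k] ab by (auto simp: supports_def)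
  have "integral {fst (z 0)..fst (z (Suc K))} (upper A)
    = integral {fst (z 0)..fst (z K)} (upper A) + integral {fst (z K)..fst (z (Suc K))} (upper A)"
  proof (rule Henstock_Kurzweil_Integration.integral_combine[symmetric])
    show "upper A integrable_on {fst (z 0)..fst (z (Suc K))}"
      using upper_integrable[OF A ab] dom[of 0] dom[of "Suc K"]
      by (rule_tac integrable_subinterval_real) auto
  qed (use Suc step in auto)
  moreover have "d * (b - a) * (fst (z (Suc K)) - fst (z 0))
    = d * (b - a) * (fst (z K) - fst (z 0)) + d * (b - a) * (fst (z (Suc K)) - fst (z K))"
    by (simp add: algebra_simps)
  ultimately show ?case using Suc step unfolding dd by (auto simp: abs_le_iff)
qed

text \<open>With \<open>m = Suc n\<close>, the slopes run through \<open>[- m, m]\<close> downwards in steps of \<open>1 / m\<close>, so that the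
  contact points are passed from left to right.\<close>
definition inscribed_sum :: "nat \<Rightarrow> (real \<Rightarrow> real \<times> real) \<Rightarrow> real" where
  "inscribed_sum n \<gamma> = (\<Sum>k<2 * (Suc n)\<^sup>2.
     trapezoid (\<gamma> (real (Suc n) - inverse (real (Suc n)) * real k))
               (\<gamma> (real (Suc n) - inverse (real (Suc n)) * real (Suc k))))"

text \<open>With step \<open>1 / m\<close>, the trapezoids contribute an error of at most
  \<open>(b - a)\<^sup>2 / m\<close>. It remains to control the two end pieces that the extreme
  slopes \<open>m\<close> and \<open>- m\<close> leave uncovered.\<close>

lemma inscribed_sum_tendsto:
  assumes A: "body A" and sup: "\<And>p. supports A p (\<gamma> p)"
  shows "(\<lambda>n. inscribed_sum n \<gamma>) \<longlonglongrightarrow> integral (fst ` A) (upper A)"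
proof -
  obtain a b where "a \<le> b" and ab: "fst ` A = {a..b}" using body_fst_interval[OF A] by blast
  obtain R where "R > 0" and R: "\<And>x y. (x, y) \<in> A \<Longrightarrow> \<bar>x\<bar> \<le> R \<and> \<bar>y\<bar> \<le> R"
    using body_bounds[OF A] by blast
  have Ru: "\<bar>upper A x\<bar> \<le> R" if "x \<in> {a..b}" for x
    using R upper_mem[OF A, of x] that ab by auto
  have bound: "\<bar>integral {a..b} (upper A) - inscribed_sum n \<gamma>\<bar>
      \<le> ((b - a)\<^sup>2 + 4 * R\<^sup>2) * inverse (real (Suc n))" for n
  proof -
    define m where "m = real (Suc n)"
    have "m > 0" by (simp add: m_def)
    define K where "K = 2 * (Suc n)\<^sup>2"
    define z where "z = (\<lambda>k. \<gamma> (m - inverse m * real k))"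
    have z: "supports A (m - inverse m * real k) (z k)" for k by (simp add: z_def sup)
    have d: "0 < inverse m" using \<open>m > 0\<close> by simp
    note ts = trapezoid_sum_approx[where z=z and K=K, OF A ab d z]
    have s: "inscribed_sum n \<gamma> = (\<Sum>k<K. trapezoid (z k) (z (Suc k)))"
      by (simp add: inscribed_sum_def K_def z_def m_def)
    have mK: "m - inverse m * real K = - m"
      using \<open>m > 0\<close> by (simp add: K_def m_def field_simps power2_eq_square)
    define x0 where "x0 = fst (z 0)"
    define x1 where "x1 = fst (z K)"
    have dom: "x0 \<in> {a..b}" "x1 \<in> {a..b}"
      using z[of 0] z[of K] ab by (auto simp: supports_def x0_def x1_def)
    have le: "x0 \<le> x1" using ts by (simp add: x0_def x1_def)
    have z0: "(x0, snd (z 0)) \<in> A" and zK: "(x1, snd (z K)) \<in> A"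
      using z[of 0] z[of K] by (auto simp: supports_def x0_def x1_def)
    have ends: "(a, upper A a) \<in> A" "(b, upper A b) \<in> A"
      using upper_mem[OF A] ab \<open>a \<le> b\<close> by auto
    \<comment> \<open>The boundary drops by at most \<open>2 * R\<close> from one point to another,
      while a supporting line of slope \<open>m\<close> forces it to rise by \<open>m\<close> times
      the distance from \<open>a\<close>. Hence the left piece has width at most
      \<open>2 * R / m\<close>; the right one is symmetric.\<close>
    have "upper A a - m * a \<le> snd (z 0) - m * x0"
      using z[of 0] ends(1) by (force simp: supports_def x0_def)
    then have "m * (x0 - a) \<le> 2 * R" using abs_le_D1[of "snd (z 0)" R] abs_le_D2[of "upper A a" R] R[OF z0] R[OF ends(1)]
      by (simp add: algebra_simps)
    then have left: "x0 - a \<le> 2 * R * inverse m" using \<open>m > 0\<close> by (simp add: field_simps)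
    have "upper A b + m * b \<le> snd (z K) + m * x1"
      using z[of K] ends(2) unfolding mK by (force simp: supports_def x1_def)
    then have "m * (b - x1) \<le> 2 * R" using abs_le_D1[of "snd (z K)" R] abs_le_D2[of "upper A b" R] R[OF zK] R[OF ends(2)]
      by (simp add: algebra_simps)
    then have right: "b - x1 \<le> 2 * R * inverse m" using \<open>m > 0\<close> by (simp add: field_simps)
    have int: "upper A integrable_on {u..v}" if "a \<le> u" "v \<le> b" for u v
      using upper_integrable[OF A ab] that by (rule_tac integrable_subinterval_real) auto
    have short: "\<bar>integral {u..v} (upper A)\<bar> \<le> R * (v - u)" if "a \<le> u" "u \<le> v" "v \<le> b" for u v
      using has_integral_bound_real[of R "{}" "upper A" "integral {u..v} (upper A)" u v] that
        int[of u v] Ru \<open>R > 0\<close> by auto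
    have "integral {a..b} (upper A) = integral {a..x0} (upper A) + integral {x0..x1} (upper A)
        + integral {x1..b} (upper A)"
      using Henstock_Kurzweil_Integration.integral_combine[of a x0 b "upper A"]
        Henstock_Kurzweil_Integration.integral_combine[of x0 x1 b "upper A"] dom le int by auto
    moreover have "\<bar>integral {a..x0} (upper A)\<bar> \<le> R * (2 * R * inverse m)"
      using short[of a x0] dom left \<open>R > 0\<close>
      by (smt (verit) atLeastAtMost_iff mult_left_mono)
    moreover have "\<bar>integral {x1..b} (upper A)\<bar> \<le> R * (2 * R * inverse m)"
      using short[of x1 b] dom right \<open>R > 0\<close>
      by (smt (verit) atLeastAtMost_iff mult_left_mono)
    moreover have "\<bar>integral {x0..x1} (upper A) - inscribed_sum n \<gamma>\<bar> \<le> inverse m * (b - a) * (b - a)"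
    proof -
      have "inverse m * (b - a) * (x1 - x0) \<le> inverse m * (b - a) * (b - a)"
        using dom \<open>m > 0\<close> by (intro mult_left_mono) auto
      then show ?thesis using ts unfolding s x0_def x1_def by linarith
    qed
    ultimately have "\<bar>integral {a..b} (upper A) - inscribed_sum n \<gamma>\<bar>
        \<le> R * (2 * R * inverse m) + R * (2 * R * inverse m) + inverse m * (b - a) * (b - a)"
      by linarith
    also have "\<dots> = ((b - a)\<^sup>2 + 4 * R\<^sup>2) * inverse m"
      by (simp add: algebra_simps power2_eq_square)
    finally show ?thesis by (simp add: m_def)
  qed
  have "(\<lambda>n. ((b - a)\<^sup>2 + 4 * R\<^sup>2) * inverse (real (Suc n))) \<longlonglongrightarrow> ((b - a)\<^sup>2 + 4 * R\<^sup>2) * 0"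
    by (intro tendsto_mult tendsto_const LIMSEQ_inverse_real_of_nat)
  then have "(\<lambda>n. integral {a..b} (upper A) - inscribed_sum n \<gamma>) \<longlonglongrightarrow> 0"
    by (rule_tac Lim_null_comparison[where g = "\<lambda>n. ((b - a)\<^sup>2 + 4 * R\<^sup>2) * inverse (real (Suc n))"])
      (use bound in auto)
  then have "(\<lambda>n. integral {a..b} (upper A) - (integral {a..b} (upper A) - inscribed_sum n \<gamma>))
      \<longlonglongrightarrow> integral {a..b} (upper A) - 0"
    by (intro tendsto_diff tendsto_const)
  then show ?thesis by (simp add: ab)
qed

section \<open>Area as a quadratic form\<close>

text \<open>The lower boundary of \<open>A\<close> is \<open>- upper (mirror A)\<close>, and
  reflection is linear, so everything proved about upper boundaries covers lower boundaries as
  well.\<close>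

definition mirror :: "(real \<times> real) set \<Rightarrow> (real \<times> real) set" where
  "mirror A = (\<lambda>z. (fst z, - snd z)) ` A"

lemma linear_mirror: "linear (\<lambda>z :: real \<times> real. (fst z, - snd z))"
  by (rule linearI) auto

lemma body_mirror: "body A \<Longrightarrow> body (mirror A)"
  unfolding mirror_def by (intro body_linear_image linear_mirror)

lemma mirror_iff: "(x, y) \<in> mirror A \<longleftrightarrow> (x, - y) \<in> A"
  by (force simp: mirror_def)

lemma fst_mirror: "fst ` mirror A = fst ` A"
  by (simp add: mirror_def image_image)

lemma mirror_plus: "mirror (A + B) = mirror A + mirror B"
  unfolding mirror_def by (rule linear_image_plus[OF linear_mirror])

lemma mirror_scaleR: "mirror ((*\<^sub>R) r ` A) = (*\<^sub>R) r ` mirror A"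
  by (simp add: mirror_def image_image)

section \<open>Vertical slices, and area as an integral of their lengths\<close>

definition slice_length :: "(real \<times> real) set \<Rightarrow> real \<Rightarrow> real" where
  "slice_length A x = measure lborel {y. (x, y) \<in> A}"

lemma vertical_slice:
  assumes A: "body A" and x: "x \<in> fst ` A"
  shows "{y. (x, y) \<in> A} = {- upper (mirror A) x..upper A x}"
    and "- upper (mirror A) x \<le> upper A x"
proof -
  have u: "(x, upper A x) \<in> A" and l: "(x, - upper (mirror A) x) \<in> A"
    using upper_mem[OF A x] upper_mem[OF body_mirror[OF A], of x] x
    by (auto simp: mirror_iff fst_mirror)
  have le: "y \<le> upper A x" "- upper (mirror A) x \<le> y" if "(x, y) \<in> A" for y
    using upper_ge[OF A that] upper_ge[OF body_mirror[OF A], of x "- y"] that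
    by (auto simp: mirror_iff)
  show "- upper (mirror A) x \<le> upper A x" using le(2)[OF u] .
  have "convex {y. (x, y) \<in> A}"
  proof (rule convexI)
    fix y z u v :: real
    assume "y \<in> {y. (x, y) \<in> A}" "z \<in> {y. (x, y) \<in> A}" and uv: "0 \<le> u" "0 \<le> v" "u + v = 1"
    then have "u *\<^sub>R (x, y) + v *\<^sub>R (x, z) \<in> A"
      using A by (intro convexD) (auto simp: body_def)
    moreover have "u * x + v * x = x" using uv by (metis distrib_right mult_1)
    ultimately show "u *\<^sub>R y + v *\<^sub>R z \<in> {y. (x, y) \<in> A}" by simp
  qed
  then have "is_interval {y. (x, y) \<in> A}" by (simp add: is_interval_convex_1)
  then have ge: "y \<in> {y. (x, y) \<in> A}" if "- upper (mirror A) x \<le> y" "y \<le> upper A x" for y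
    using that u l by (intro mem_is_interval_1_I[of _ "- upper (mirror A) x" "upper A x" y]) auto
  show "{y. (x, y) \<in> A} = {- upper (mirror A) x..upper A x}"
  proof (intro equalityI subsetI)
    fix y
    show "y \<in> {- upper (mirror A) x..upper A x}" if "y \<in> {y. (x, y) \<in> A}"
      using le[of y] that by simp
    show "y \<in> {y. (x, y) \<in> A}" if "y \<in> {- upper (mirror A) x..upper A x}"
      using that by (intro ge) simp_all
  qed
qed

lemma slice_length_eq:
  assumes "body A" "x \<in> fst ` A"
  shows "slice_length A x = upper A x + upper (mirror A) x"
  using vertical_slice[OF assms] by (simp add: slice_length_def)

lemma slice_length_outside:
  assumes "x \<notin> fst ` A"
  shows "slice_length A x = 0"
proof -
  have "{y. (x, y) \<in> A} = {}" using assms by force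
  then show ?thesis by (simp add: slice_length_def)
qed

lemma slice_length_nonneg: "0 \<le> slice_length A x"
  by (simp add: slice_length_def)

text \<open>Tonelli's theorem in the first coordinate. Slices of a compact set have finite length,
  so the real-valued \<open>slice_length\<close> loses nothing against the extended measure.\<close>

lemma
  assumes A: "body A"
  shows borel_measurable_slice_length: "slice_length A \<in> borel_measurable borel"
    and emeasure_eq_slices: "emeasure lborel A = (\<integral>\<^sup>+ x. slice_length A x \<partial>lborel)"
proof -
  have "A \<in> sets borel" using A by (auto simp: body_def borel_compact)
  then have S: "A \<in> sets (lborel \<Otimes>\<^sub>M lborel)" unfolding lborel_prod by simp
  have e: "emeasure lborel (Pair x -` A) = ennreal (slice_length A x)" for x
  proof -
    have "compact {y. (x, y) \<in> A}" using A by (rule vertical_slice_compact)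
    then have "emeasure lborel {y. (x, y) \<in> A} \<noteq> \<infinity>"
      using emeasure_compact_finite by fastforce
    then have "emeasure lborel {y. (x, y) \<in> A} = ennreal (slice_length A x)"
      unfolding slice_length_def by (intro emeasure_eq_ennreal_measure) auto
    moreover have "Pair x -` A = {y. (x, y) \<in> A}" by auto
    ultimately show ?thesis by simp
  qed
  have "(\<lambda>x. emeasure lborel (Pair x -` A)) \<in> borel_measurable lborel"
    using S by (rule lborel.measurable_emeasure_Pair)
  then have "(\<lambda>x. enn2real (ennreal (slice_length A x))) \<in> borel_measurable borel"
    unfolding e by measurable
  then show "slice_length A \<in> borel_measurable borel" by (simp add: slice_length_nonneg)
  have "emeasure (lborel \<Otimes>\<^sub>M lborel) A = (\<integral>\<^sup>+ x. emeasure lborel (Pair x -` A) \<partial>lborel)"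
    using S by (rule lborel.emeasure_pair_measure_alt)
  then show "emeasure lborel A = (\<integral>\<^sup>+ x. slice_length A x \<partial>lborel)"
    by (simp add: e lborel_prod)
qed

abbreviation area :: "(real \<times> real) set \<Rightarrow> real" where
  "area A \<equiv> measure lborel A"

lemma emeasure_body:
  fixes A :: "'a::euclidean_space set"
  assumes "body A"
  shows "emeasure lborel A = ennreal (measure lborel A)"
  using assms emeasure_compact_finite[of A]
  by (intro emeasure_eq_ennreal_measure) (auto simp: body_def)

text \<open>The slice length is the upper minus the lower boundary. Each integral alone may have
  either sign; only their sum is an area.\<close>

lemma area_eq_integrals:
  assumes A: "body A"
  shows "area A = integral (fst ` A) (upper A) + integral (fst ` mirror A) (upper (mirror A))"
    (is "_ = ?I")
proof -
  obtain a b where ab: "fst ` A = {a..b}" by (rule body_fst_interval[OF A])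
  have "(upper A has_integral integral (fst ` A) (upper A)) (fst ` A)"
    using upper_integrable[OF A ab] unfolding ab by (rule integrable_integral)
  moreover have "(upper (mirror A) has_integral integral (fst ` mirror A) (upper (mirror A))) (fst ` A)"
    using upper_integrable[OF body_mirror[OF A], of a b] unfolding fst_mirror ab
    by (simp add: integrable_integral)
  ultimately have "((\<lambda>x. upper A x + upper (mirror A) x) has_integral ?I) (fst ` A)"
    by (rule has_integral_add)
  then have I: "(slice_length A has_integral ?I) (fst ` A)"
    by (rule has_integral_eq[rotated]) (simp add: slice_length_eq[OF A])
  have "0 \<le> ?I" using I by (rule has_integral_nonneg) (rule slice_length_nonneg)
  have "emeasure lborel A = (\<integral>\<^sup>+ x. ennreal (slice_length A x) * indicator (fst ` A) x \<partial>lborel)"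
    unfolding emeasure_eq_slices[OF A]
    by (intro nn_integral_cong) (simp add: indicator_def slice_length_outside)
  also have "\<dots> = ennreal ?I"
    by (rule nn_integral_has_integral_lebesgue'[OF slice_length_nonneg I])
  finally have "ennreal (area A) = ennreal ?I" by (simp only: emeasure_body[OF A])
  then show ?thesis using \<open>0 \<le> ?I\<close> by (metis ennreal_inj measure_nonneg)
qed

text \<open>It suffices to expand a single trapezoid. The cross coefficients are written by
  polarisation, through sums of two families, because those sums are again contact points of
  Minkowski sums.\<close>

lemma inscribed_sum_quadratic:
  "inscribed_sum n (\<lambda>p. r *\<^sub>R \<alpha> p + s *\<^sub>R \<beta> p + t *\<^sub>R \<gamma> p) =
    r\<^sup>2 * inscribed_sum n \<alpha> + s\<^sup>2 * inscribed_sum n \<beta> + t\<^sup>2 * inscribed_sum n \<gamma>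
    + r * s * (inscribed_sum n (\<lambda>p. \<alpha> p + \<beta> p) - inscribed_sum n \<alpha> - inscribed_sum n \<beta>)
    + r * t * (inscribed_sum n (\<lambda>p. \<alpha> p + \<gamma> p) - inscribed_sum n \<alpha> - inscribed_sum n \<gamma>)
    + s * t * (inscribed_sum n (\<lambda>p. \<beta> p + \<gamma> p) - inscribed_sum n \<beta> - inscribed_sum n \<gamma>)"
proof -
  have "trapezoid (r *\<^sub>R a + s *\<^sub>R b + t *\<^sub>R c) (r *\<^sub>R a' + s *\<^sub>R b' + t *\<^sub>R c') =
    r\<^sup>2 * trapezoid a a' + s\<^sup>2 * trapezoid b b' + t\<^sup>2 * trapezoid c c'
    + r * s * (trapezoid (a + b) (a' + b') - trapezoid a a' - trapezoid b b')
    + r * t * (trapezoid (a + c) (a' + c') - trapezoid a a' - trapezoid c c')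
    + s * t * (trapezoid (b + c) (b' + c') - trapezoid b b' - trapezoid c c')" for a b c a' b' c'
  proof -
    have trapezoid2: "trapezoid z w = (snd z + snd w) * (fst w - fst z) * (1 / 2)" for z w
      by (simp add: trapezoid_def)
    show ?thesis
      unfolding trapezoid2 fst_add snd_add fst_scaleR snd_scaleR real_scaleR_def by algebra
  qed
  then show ?thesis
    unfolding inscribed_sum_def
    by (simp only: sum.distrib sum_subtractf flip: sum_distrib_left)
qed

text \<open>The mixed area, that is, the polar form of the area; with the factor 1/2,
  \<open>mixed A A = area A\<close> for a body \<open>A\<close>.\<close>

definition mixed :: "(real \<times> real) set \<Rightarrow> (real \<times> real) set \<Rightarrow> real" where
  "mixed A B = (area (A + B) - area A - area B) / 2"

section \<open>Area of nonnegative combinations of three bodies\<close>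

definition combination ::
  "(real \<times> real) set \<Rightarrow> (real \<times> real) set \<Rightarrow> (real \<times> real) set \<Rightarrow> real \<Rightarrow> real \<Rightarrow> real \<Rightarrow> (real \<times> real) set"
  where "combination A B C r s t = (*\<^sub>R) r ` A + (*\<^sub>R) s ` B + (*\<^sub>R) t ` C"

lemma body_combination:
  "body A \<Longrightarrow> body B \<Longrightarrow> body C \<Longrightarrow> body (combination A B C r s t)"
  unfolding combination_def by (intro body_plus body_scaleR)

lemma mirror_combination:
  "mirror (combination A B C r s t) = combination (mirror A) (mirror B) (mirror C) r s t"
  by (simp add: combination_def mirror_plus mirror_scaleR)

definition upper_area :: "(real \<times> real) set \<Rightarrow> real" where
  "upper_area A = integral (fst ` A) (upper A)"

text \<open>Both sides are limits of the same sequence, since the combined contact points are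
  contact points of the combined body. Nonnegative coefficients matter here: a negative one would
  turn maximisers into minimisers.\<close>

lemma upper_area_quadratic:
  assumes A: "body A" and B: "body B" and C: "body C" and nn: "0 \<le> r" "0 \<le> s" "0 \<le> t"
  shows "upper_area (combination A B C r s t) =
    r\<^sup>2 * upper_area A + s\<^sup>2 * upper_area B + t\<^sup>2 * upper_area C
    + r * s * (upper_area (A + B) - upper_area A - upper_area B)
    + r * t * (upper_area (A + C) - upper_area A - upper_area C)
    + s * t * (upper_area (B + C) - upper_area B - upper_area C)"
proof -
  obtain \<alpha> where \<alpha>: "\<And>p. supports A p (\<alpha> p)" using supports_exists[OF A] by metis
  obtain \<beta> where \<beta>: "\<And>p. supports B p (\<beta> p)" using supports_exists[OF B] by metis
  obtain \<gamma> where \<gamma>: "\<And>p. supports C p (\<gamma> p)" using supports_exists[OF C] by metis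
  note lim = inscribed_sum_tendsto[folded upper_area_def]
  have "(\<lambda>n. inscribed_sum n (\<lambda>p. r *\<^sub>R \<alpha> p + s *\<^sub>R \<beta> p + t *\<^sub>R \<gamma> p))
      \<longlonglongrightarrow> upper_area (combination A B C r s t)"
    by (rule lim[OF body_combination[OF A B C]])
      (unfold combination_def, intro supports_plus supports_scaleR \<alpha> \<beta> \<gamma> nn)
  moreover have "(\<lambda>n. inscribed_sum n (\<lambda>p. r *\<^sub>R \<alpha> p + s *\<^sub>R \<beta> p + t *\<^sub>R \<gamma> p)) \<longlonglongrightarrow>
    r\<^sup>2 * upper_area A + s\<^sup>2 * upper_area B + t\<^sup>2 * upper_area C
    + r * s * (upper_area (A + B) - upper_area A - upper_area B)
    + r * t * (upper_area (A + C) - upper_area A - upper_area C)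
    + s * t * (upper_area (B + C) - upper_area B - upper_area C)"
    unfolding inscribed_sum_quadratic
    by (intro tendsto_add tendsto_diff tendsto_mult_left
        lim[OF A \<alpha>] lim[OF B \<beta>] lim[OF C \<gamma>] lim[OF body_plus[OF A B] supports_plus[OF \<alpha> \<beta>]]
        lim[OF body_plus[OF A C] supports_plus[OF \<alpha> \<gamma>]] lim[OF body_plus[OF B C] supports_plus[OF \<beta> \<gamma>]])
  ultimately show ?thesis by (rule LIMSEQ_unique)
qed

lemma area_quadratic:
  assumes "body A" "body B" "body C" "0 \<le> r" "0 \<le> s" "0 \<le> t"
  shows "area (combination A B C r s t) =
    r\<^sup>2 * area A + s\<^sup>2 * area B + t\<^sup>2 * area C
    + 2 * r * s * mixed A B + 2 * r * t * mixed A C + 2 * s * t * mixed B C"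
proof -
  have area: "area K = upper_area K + upper_area (mirror K)" if "body K" for K
    using area_eq_integrals[OF that] by (simp add: upper_area_def)
  have mix: "2 * x * y * mixed K L = x * y * (upper_area (K + L) - upper_area K - upper_area L)
      + x * y * (upper_area (mirror K + mirror L) - upper_area (mirror K) - upper_area (mirror L))"
    if "body K" "body L" for x y K L
  proof -
    have "2 * x * y * mixed K L = x * y * (area (K + L) - area K - area L)"
      by (simp add: mixed_def)
    also have "\<dots> = x * y * (upper_area (K + L) + upper_area (mirror K + mirror L)
        - (upper_area K + upper_area (mirror K)) - (upper_area L + upper_area (mirror L)))"
      unfolding area[OF that(1)] area[OF that(2)] area[OF body_plus[OF that]] mirror_plus ..
    finally show ?thesis by (simp add: algebra_simps)
  qed
  show ?thesis
    unfolding area[OF body_combination[OF assms(1-3)]] mirror_combination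
      upper_area_quadratic[OF assms]
      upper_area_quadratic[OF assms(1-3)[THEN body_mirror] assms(4-6)]
      mix[OF assms(1,2)] mix[OF assms(1,3)] mix[OF assms(2,3)] area[OF assms(1)]
      area[OF assms(2)] area[OF assms(3)]
    by (simp only: distrib_left ac_simps)
qed

section \<open>The Brunn--Minkowski inequality\<close>

text \<open>Tonelli: for fixed \<open>x\<close>, the levels \<open>s\<close> in the unit interval
  with \<open>s * M \<le> f x\<close> have total length \<open>min (f x / M) 1\<close>. Levels are
  measured as fractions of \<open>M\<close> so that functions with different maxima can be compared
  at equal fractions.\<close>

lemma layer_cake:
  fixes f :: "real \<Rightarrow> real"
  assumes [measurable]: "f \<in> borel_measurable borel" and "\<And>x. 0 \<le> f x" and "0 < M"
  shows "ennreal M * (\<integral>\<^sup>+ s. emeasure lborel {x. s * M \<le> f x} * indicator {0<..<1} s \<partial>lborel)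
    = (\<integral>\<^sup>+ x. ennreal (min (f x) M) \<partial>lborel)"
proof -
  have "(\<integral>\<^sup>+ s. emeasure lborel {x. s * M \<le> f x} * indicator {0<..<1} s \<partial>lborel)
    = (\<integral>\<^sup>+ s. \<integral>\<^sup>+ x. indicator {0<..<1} s * indicator {x. s * M \<le> f x} x \<partial>lborel \<partial>lborel)"
    by (intro nn_integral_cong) (simp add: nn_integral_cmult mult.commute)
  also have "\<dots> = (\<integral>\<^sup>+ x. \<integral>\<^sup>+ s. indicator {0<..<1} s * indicator {x. s * M \<le> f x} x \<partial>lborel \<partial>lborel)"
    by (rule lborel_pair.Fubini') (simp add: indicator_def case_prod_unfold)
  finally have "ennreal M * (\<integral>\<^sup>+ s. emeasure lborel {x. s * M \<le> f x} * indicator {0<..<1} s \<partial>lborel)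
    = ennreal M * (\<integral>\<^sup>+ x. \<integral>\<^sup>+ s. indicator {0<..<1} s * indicator {x. s * M \<le> f x} x \<partial>lborel \<partial>lborel)"
    by simp
  also have "\<dots> = (\<integral>\<^sup>+ x. ennreal M *
      (\<integral>\<^sup>+ s. indicator {0<..<1} s * indicator {x. s * M \<le> f x} x \<partial>lborel) \<partial>lborel)"
    by (rule nn_integral_cmult[symmetric]) (simp add: indicator_def)
  also have "\<dots> = (\<integral>\<^sup>+ x. ennreal (min (f x) M) \<partial>lborel)"
  proof (intro nn_integral_cong)
    fix x
    have "(\<integral>\<^sup>+ s. indicator {0<..<1} s * indicator {x. s * M \<le> f x} x \<partial>lborel)
      = (\<integral>\<^sup>+ s. indicator ({0<..<1} \<inter> {s. s * M \<le> f x}) s \<partial>lborel)"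
      by (intro nn_integral_cong) (auto simp: indicator_def)
    also have "\<dots> = emeasure lborel ({0<..<1} \<inter> {s. s * M \<le> f x})"
      by (rule nn_integral_indicator) simp
    also have "\<dots> = ennreal (min (f x / M) 1)"
    proof (cases "f x / M < 1")
      case True
      then have "{0<..<1} \<inter> {s. s * M \<le> f x} = {0<..f x / M}"
        unfolding pos_le_divide_eq[OF \<open>0 < M\<close>, symmetric] by fastforce
      then show ?thesis using True \<open>0 < M\<close> \<open>0 \<le> f x\<close> by (simp add: min_def)
    next
      case False
      then have "{0<..<1} \<inter> {s. s * M \<le> f x} = {0<..<1}"
        unfolding pos_le_divide_eq[OF \<open>0 < M\<close>, symmetric] by fastforce
      then show ?thesis using False by (simp add: min_def)
    qed
    finally have "ennreal M * (\<integral>\<^sup>+ s. indicator {0<..<1} s * indicator {x. s * M \<le> f x} x \<partial>lborel)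
        = ennreal M * ennreal (min (f x / M) 1)" by simp
    also have "\<dots> = ennreal (M * min (f x / M) 1)"
      using \<open>0 < M\<close> \<open>0 \<le> f x\<close> by (simp add: ennreal_mult)
    also have "M * min (f x / M) 1 = min (f x) M"
      using \<open>0 < M\<close> by (simp add: min_mult_distrib_left)
    finally show "ennreal M * (\<integral>\<^sup>+ s. indicator {0<..<1} s * indicator {x. s * M \<le> f x} x \<partial>lborel)
        = ennreal (min (f x) M)" .
  qed
  finally show ?thesis .
qed

text \<open>The one-dimensional Brunn-Minkowski inequality for intervals: infima and suprema add.
  Whether endpoints belong to the sets is irrelevant, because the open interval between the added
  bounds already lies in \<open>I + J\<close>.\<close>

lemma emeasure_interval_sum:
  fixes I J K :: "real set"
  assumes I: "convex I" "I \<noteq> {}" "bounded I" and J: "convex J" "J \<noteq> {}" "bounded J"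
    and K: "I + J \<subseteq> K" "K \<in> sets borel"
  shows "emeasure lborel I + emeasure lborel J \<le> emeasure lborel K"
proof -
  note bdd = bounded_imp_bdd_above[OF I(3)] bounded_imp_bdd_below[OF I(3)]
    bounded_imp_bdd_above[OF J(3)] bounded_imp_bdd_below[OF J(3)]
  have le: "emeasure lborel L \<le> ennreal (Sup L - Inf L)" "Inf L \<le> Sup L"
    if "L \<noteq> {}" "bdd_above L" "bdd_below L" for L :: "real set"
  proof -
    show "Inf L \<le> Sup L" using that by (rule cInf_le_cSup)
    have "L \<subseteq> {Inf L..Sup L}" using that by (auto intro: cInf_lower cSup_upper)
    then have "emeasure lborel L \<le> emeasure lborel {Inf L..Sup L}" by (rule emeasure_mono) simp
    then show "emeasure lborel L \<le> ennreal (Sup L - Inf L)" using \<open>Inf L \<le> Sup L\<close> by simp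
  qed
  have "{Inf I + Inf J<..<Sup I + Sup J} \<subseteq> K"
  proof
    fix z assume z: "z \<in> {Inf I + Inf J<..<Sup I + Sup J}"
    \<comment> \<open>The next lines find \<open>x + y < z\<close> and \<open>z < x' + y'\<close> in
      the sum; as \<open>I + J\<close> is an interval, it then contains \<open>z\<close>.\<close>
    then have "Inf I < z - Inf J" by simp
    then obtain x where x: "x \<in> I" "x < z - Inf J" using I(2) bdd by (auto simp: cInf_less_iff)
    then have "Inf J < z - x" by simp
    then obtain y where y: "y \<in> J" "y < z - x" using J(2) bdd by (auto simp: cInf_less_iff)
    have "z - Sup J < Sup I" using z by simp
    then obtain x' where x': "x' \<in> I" "z - Sup J < x'" using I(2) bdd by (auto simp: less_cSup_iff)
    then have "z - x' < Sup J" by simp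
    then obtain y' where y': "y' \<in> J" "z - x' < y'" using J(2) bdd by (auto simp: less_cSup_iff)
    have "is_interval (I + J)"
      using convex_set_plus[OF I(1) J(1)] by (simp add: is_interval_convex_1)
    moreover have "x + y \<in> I + J" "x' + y' \<in> I + J"
      using x y x' y' by (auto intro: set_plus_intro)
    ultimately have "z \<in> I + J"
      using y y' by (intro mem_is_interval_1_I[of "I + J" "x + y" "x' + y'" z]) auto
    then show "z \<in> K" using K by blast
  qed
  then have "emeasure lborel {Inf I + Inf J<..<Sup I + Sup J} \<le> emeasure lborel K"
    using K(2) by (intro emeasure_mono) auto
  then have "ennreal (Sup I - Inf I + (Sup J - Inf J)) \<le> emeasure lborel K"
    using le(2)[of I] le(2)[of J] I(2) J(2) bdd by (simp add: algebra_simps)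
  moreover have "emeasure lborel I + emeasure lborel J \<le> ennreal (Sup I - Inf I) + ennreal (Sup J - Inf J)"
    using le(1)[of I] le(1)[of J] I(2) J(2) bdd by (intro add_mono) auto
  moreover have "ennreal (Sup I - Inf I) + ennreal (Sup J - Inf J) = ennreal (Sup I - Inf I + (Sup J - Inf J))"
    using le(2)[of I] le(2)[of J] I(2) J(2) bdd by (intro ennreal_plus[symmetric]) auto
  ultimately show ?thesis by simp
qed

section \<open>Slice lengths of a Minkowski sum and Bonnesen's inequality\<close>

lemma slice_length_superadditive:
  assumes "body A" "body B" "x \<in> fst ` A" "y \<in> fst ` B"
  shows "slice_length A x + slice_length B y \<le> slice_length (A + B) (x + y)"
  using upper_superadditive[OF assms] upper_superadditive(2)[OF body_mirror body_mirror, of A B x y] assms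
  by (simp add: slice_length_eq body_plus mirror_plus fst_mirror)

text \<open>On the projection, the slice length is a sum of two concave functions, and outside it
  vanishes; a positive level therefore cuts out an interval inside the projection.\<close>

lemma convex_slice_level:
  assumes A: "body A" and "0 < c"
  shows "convex {x. c \<le> slice_length A x}" "{x. c \<le> slice_length A x} \<subseteq> fst ` A"
proof -
  show sub: "{x. c \<le> slice_length A x} \<subseteq> fst ` A"
    using slice_length_outside[of _ A] \<open>0 < c\<close> by fastforce
  show "convex {x. c \<le> slice_length A x}"
  proof (rule convexI)
    fix x y u v :: real
    assume xy: "x \<in> {x. c \<le> slice_length A x}" "y \<in> {x. c \<le> slice_length A x}"
      and uv: "0 \<le> u" "0 \<le> v" "u + v = 1"
    then have d: "x \<in> fst ` A" "y \<in> fst ` A" using sub by blast+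
    have "c = u * c + v * c" using uv by (metis distrib_right mult_1)
    also have "\<dots> \<le> u * slice_length A x + v * slice_length A y"
      using xy uv by (intro add_mono mult_left_mono) auto
    also have "\<dots> \<le> slice_length A (u * x + v * y)"
      using upper_concave[OF A d uv] upper_concave(2)[OF body_mirror[OF A], of x y u v] d uv
      by (simp add: slice_length_eq A fst_mirror algebra_simps)
    finally show "u *\<^sub>R x + v *\<^sub>R y \<in> {x. c \<le> slice_length A x}" by simp
  qed
qed

definition max_slice :: "(real \<times> real) set \<Rightarrow> real" where
  "max_slice A = Sup (range (slice_length A))"

lemma slice_length_bdd:
  assumes A: "body A"
  shows "bdd_above (range (slice_length A))"
proof -
  obtain R where "R > 0" and R: "\<And>x y. (x, y) \<in> A \<Longrightarrow> \<bar>x\<bar> \<le> R \<and> \<bar>y\<bar> \<le> R"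
    using body_bounds[OF A] by blast
  have "slice_length A x \<le> 2 * R" for x
  proof (cases "x \<in> fst ` A")
    case True
    have "\<bar>upper A x\<bar> \<le> R" "\<bar>- upper (mirror A) x\<bar> \<le> R"
      using R[OF upper_mem[OF A True]] R[of x "- upper (mirror A) x"]
        upper_mem[OF body_mirror[OF A], of x] True
      by (auto simp: mirror_iff fst_mirror)
    then show ?thesis using slice_length_eq[OF A True] by linarith
  qed (use \<open>R > 0\<close> slice_length_outside in auto)
  then show ?thesis by (intro bdd_aboveI2)
qed

lemma slice_length_le_max: "body A \<Longrightarrow> slice_length A x \<le> max_slice A"
  unfolding max_slice_def by (intro cSup_upper slice_length_bdd) auto

lemma max_slice_pos:
  assumes A: "body A" and "0 < area A"
  shows "0 < max_slice A"
proof (rule ccontr)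
  assume "\<not> 0 < max_slice A"
  then have "slice_length A x = 0" for x
    using slice_length_le_max[OF A, of x] slice_length_nonneg[of A x] by linarith
  then have "emeasure lborel A = 0" by (simp add: emeasure_eq_slices[OF A])
  then show False using \<open>0 < area A\<close> by (simp add: measure_def)
qed

text \<open>At each fraction \<open>s\<close>, superadditivity of slice lengths puts the sum of the
  level sets at \<open>s * a\<close> and \<open>s * b\<close> into the level set of
  \<open>A + B\<close> at \<open>s * (a + b)\<close>. The one-dimensional inequality compares their
  lengths, and integration over \<open>s\<close> turns lengths into areas.\<close>

lemma bonnesen_inequality:
  assumes A: "body A" "0 < area A" and B: "body B" "0 < area B"
  shows "(max_slice A + max_slice B) * (area A / max_slice A + area B / max_slice B) \<le> area (A + B)"
proof -
  define a b where "a = max_slice A" and "b = max_slice B"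
  have pos: "0 < a" "0 < b" using max_slice_pos A B by (auto simp: a_def b_def)
  \<comment> \<open>\<open>c * E K c\<close> is the integral of the slice length capped at
    \<open>c\<close>. For \<open>c = max_slice K\<close> the cap has no effect and the integral is
    the full area.\<close>
  define E where "E = (\<lambda>K c. \<integral>\<^sup>+ s. emeasure lborel {x. s * c \<le> slice_length K x} * indicator {0<..<1} s \<partial>lborel)"
  have E: "ennreal c * E K c = (\<integral>\<^sup>+ x. ennreal (min (slice_length K x) c) \<partial>lborel)"
    if "body K" "0 < c" for K c
    unfolding E_def
    using that by (intro layer_cake borel_measurable_slice_length slice_length_nonneg)
  have E_max: "E K (max_slice K) = ennreal (area K / max_slice K)" if K: "body K" "0 < area K" for K
  proof -
    define c where "c = max_slice K"
    have c: "0 < c" using max_slice_pos[OF K] by (simp add: c_def)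
    have "ennreal c * E K c = (\<integral>\<^sup>+ x. slice_length K x \<partial>lborel)"
      unfolding E[OF K(1) c] using slice_length_le_max[OF K(1)]
      by (intro nn_integral_cong) (simp add: c_def min_def)
    also have "\<dots> = ennreal (area K)"
      by (simp add: emeasure_eq_slices[OF K(1), symmetric] emeasure_body[OF K(1)])
    finally have "ennreal (1 / c) * (ennreal c * E K c) = ennreal (1 / c) * ennreal (area K)" by simp
    moreover have "ennreal (1 / c) * (ennreal c * E K c) = E K c"
      using c by (simp add: mult.assoc[symmetric] flip: ennreal_mult)
    moreover have "ennreal (1 / c) * ennreal (area K) = ennreal (area K / c)"
      using c by (simp flip: ennreal_mult)
    ultimately show ?thesis by (simp add: c_def)
  qed
  have "emeasure lborel {x. s * a \<le> slice_length A x} + emeasure lborel {x. s * b \<le> slice_length B x}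
      \<le> emeasure lborel {x. s * (a + b) \<le> slice_length (A + B) x}" if s: "0 < s" "s < 1" for s
  proof (rule emeasure_interval_sum)
    have level: "convex {x. s * max_slice K \<le> slice_length K x}"
        "{x. s * max_slice K \<le> slice_length K x} \<noteq> {}"
        "bounded {x. s * max_slice K \<le> slice_length K x}"
        "{x. s * max_slice K \<le> slice_length K x} \<subseteq> fst ` K" if K: "body K" "0 < area K" for K
    proof -
      have c: "0 < s * max_slice K" using max_slice_pos[OF K] s by simp
      show "convex {x. s * max_slice K \<le> slice_length K x}"
        and sub: "{x. s * max_slice K \<le> slice_length K x} \<subseteq> fst ` K"
        using convex_slice_level[OF K(1) c] by auto
      have "body (fst ` K)" using K(1) by (intro body_linear_image linear_fst)
      then show "bounded {x. s * max_slice K \<le> slice_length K x}"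
        using sub by (meson body_def bounded_subset compact_imp_bounded)
      \<comment> \<open>As \<open>s\<close> is less than 1, some slice exceeds the level by the
        definition of a supremum, with no appeal to the maximum being attained.\<close>
      have "s * max_slice K < max_slice K" using max_slice_pos[OF K] s by simp
      then obtain x where "s * max_slice K < slice_length K x"
        using less_cSup_iff[OF _ slice_length_bdd[OF K(1)]] unfolding max_slice_def[of K] by blast
      then have "x \<in> {x. s * max_slice K \<le> slice_length K x}" by simp
      then show "{x. s * max_slice K \<le> slice_length K x} \<noteq> {}" by blast
    qed
    note A' = level[OF A, folded a_def] and B' = level[OF B, folded b_def]
    show "convex {x. s * a \<le> slice_length A x}" "{x. s * a \<le> slice_length A x} \<noteq> {}"
      "bounded {x. s * a \<le> slice_length A x}" "convex {x. s * b \<le> slice_length B x}"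
      "{x. s * b \<le> slice_length B x} \<noteq> {}" "bounded {x. s * b \<le> slice_length B x}"
      using A' B' by blast+
    show "{x. s * a \<le> slice_length A x} + {x. s * b \<le> slice_length B x}
        \<subseteq> {x. s * (a + b) \<le> slice_length (A + B) x}"
    proof
      fix z assume "z \<in> {x. s * a \<le> slice_length A x} + {x. s * b \<le> slice_length B x}"
      then obtain x y where z: "z = x + y" and xy: "s * a \<le> slice_length A x" "s * b \<le> slice_length B y"
        by (auto elim!: set_plus_elim)
      then have "x \<in> fst ` A" "y \<in> fst ` B" using A'(4) B'(4) by blast+
      then have "slice_length A x + slice_length B y \<le> slice_length (A + B) (x + y)"
        by (rule slice_length_superadditive[OF A(1) B(1)])
      then show "z \<in> {x. s * (a + b) \<le> slice_length (A + B) x}"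
        using xy by (simp add: z distrib_left)
    qed
    show "{x. s * (a + b) \<le> slice_length (A + B) x} \<in> sets borel"
      using borel_measurable_slice_length[OF body_plus[OF A(1) B(1)]] by measurable
  qed
  then have "(\<integral>\<^sup>+ s. emeasure lborel {x. s * a \<le> slice_length A x} * indicator {0<..<1} s
      + emeasure lborel {x. s * b \<le> slice_length B x} * indicator {0<..<1} s \<partial>lborel) \<le> E (A + B) (a + b)"
    unfolding E_def by (intro nn_integral_mono) (auto simp: indicator_def)
  also have "(\<integral>\<^sup>+ s. emeasure lborel {x. s * a \<le> slice_length A x} * indicator {0<..<1} s
      + emeasure lborel {x. s * b \<le> slice_length B x} * indicator {0<..<1} s \<partial>lborel) = E A a + E B b"
    unfolding E_def
  proof (rule nn_integral_add)
    have [measurable]: "slice_length A \<in> borel_measurable borel" "slice_length B \<in> borel_measurable borel"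
      using A B borel_measurable_slice_length by auto
    show "(\<lambda>s. emeasure lborel {x. s * a \<le> slice_length A x} * indicator {0<..<1} s) \<in> borel_measurable lborel"
      "(\<lambda>s. emeasure lborel {x. s * b \<le> slice_length B x} * indicator {0<..<1} s) \<in> borel_measurable lborel"
      by measurable
  qed
  finally have le: "E A a + E B b \<le> E (A + B) (a + b)" .
  have "ennreal (a + b) * (E A a + E B b) \<le> ennreal (a + b) * E (A + B) (a + b)"
    using le by (rule mult_left_mono) simp
  also have "\<dots> = (\<integral>\<^sup>+ x. ennreal (min (slice_length (A + B) x) (a + b)) \<partial>lborel)"
    using E[OF body_plus[OF A(1) B(1)], of "a + b"] pos by simp
  \<comment> \<open>Slices of \<open>A + B\<close> may be longer than \<open>a + b\<close>; dropping
    the cap only increases the integral.\<close>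
  also have "\<dots> \<le> (\<integral>\<^sup>+ x. slice_length (A + B) x \<partial>lborel)"
    by (intro nn_integral_mono ennreal_leI) simp
  also have "\<dots> = ennreal (area (A + B))"
    using body_plus[OF A(1) B(1)] by (simp add: emeasure_eq_slices[symmetric] emeasure_body)
  finally have "ennreal (a + b) * (ennreal (area A / a) + ennreal (area B / b)) \<le> ennreal (area (A + B))"
    using E_max[OF A] E_max[OF B] by (simp add: a_def b_def)
  then have "ennreal ((a + b) * (area A / a + area B / b)) \<le> ennreal (area (A + B))"
    using pos by (simp add: ennreal_mult)
  then show ?thesis by (simp add: a_def b_def)
qed

text \<open>Expanding the product in Bonnesen's inequality leaves, besides the two areas, two terms
  \<open>u\<close> and \<open>v\<close> with product \<open>area A * area B\<close>; the
  arithmetic-geometric mean inequality finishes.\<close>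

lemma minkowski_first_inequality:
  assumes "body A" "0 < area A" "body B" "0 < area B"
  shows "sqrt (area A * area B) \<le> mixed A B"
proof -
  define a b where "a = max_slice A" and "b = max_slice B"
  have ab: "0 < a" "0 < b" using max_slice_pos assms by (auto simp: a_def b_def)
  define u v where "u = b / a * area A" and "v = a / b * area B"
  have uv: "u * v = area A * area B" using ab by (simp add: u_def v_def)
  have "(a + b) * (area A / a + area B / b) \<le> area (A + B)"
    using bonnesen_inequality assms by (simp add: a_def b_def)
  moreover have "(a + b) * (area A / a + area B / b) = area A + area B + u + v"
    using ab by (simp add: u_def v_def field_simps)
  ultimately have "(u + v) / 2 \<le> mixed A B" by (simp add: mixed_def)
  moreover have "sqrt (u * v) \<le> (u + v) / 2"
    using ab by (intro arith_geo_mean_sqrt) (simp_all add: u_def v_def)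
  ultimately show ?thesis using uv by simp
qed

section \<open>The reversed Cauchy--Schwarz inequality\<close>

text \<open>Convexity gives the inclusion from right to left:
  \<open>r *\<^sub>R x + r' *\<^sub>R y\<close> is \<open>r + r'\<close> times a convex combination
  of \<open>x\<close> and \<open>y\<close>.\<close>

lemma scaleR_image_add:
  fixes A :: "'a::real_vector set"
  assumes "convex A" "0 \<le> r" "0 \<le> r'"
  shows "(*\<^sub>R) (r + r') ` A = (*\<^sub>R) r ` A + (*\<^sub>R) r' ` A"
proof (intro equalityI subsetI)
  fix z assume "z \<in> (*\<^sub>R) (r + r') ` A"
  then obtain x where "x \<in> A" "z = r *\<^sub>R x + r' *\<^sub>R x" by (auto simp: scaleR_left_distrib)
  then show "z \<in> (*\<^sub>R) r ` A + (*\<^sub>R) r' ` A" by (metis imageI set_plus_intro)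
next
  fix z assume "z \<in> (*\<^sub>R) r ` A + (*\<^sub>R) r' ` A"
  then obtain x y where xy: "x \<in> A" "y \<in> A" and z: "z = r *\<^sub>R x + r' *\<^sub>R y"
    by (auto elim!: set_plus_elim)
  show "z \<in> (*\<^sub>R) (r + r') ` A"
  proof (cases "r + r' = 0")
    case True
    then have "r = 0" "r' = 0" using assms by auto
    then have "z = (r + r') *\<^sub>R x" using z by simp
    then show ?thesis using xy by blast
  next
    case False
    then have "0 < r + r'" using assms by linarith
    then have "(r / (r + r')) *\<^sub>R x + (r' / (r + r')) *\<^sub>R y \<in> A"
      using assms xy by (intro convexD) (auto simp flip: add_divide_distrib)
    moreover have "z = (r + r') *\<^sub>R ((r / (r + r')) *\<^sub>R x + (r' / (r + r')) *\<^sub>R y)"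
      using False by (simp add: z scaleR_right_distrib)
    ultimately show ?thesis by blast
  qed
qed

lemma combination_add:
  assumes "body A" "body B" "body C" "0 \<le> r" "0 \<le> s" "0 \<le> t" "0 \<le> r'" "0 \<le> s'" "0 \<le> t'"
  shows "combination A B C r s t + combination A B C r' s' t'
    = combination A B C (r + r') (s + s') (t + t')"
  using assms by (simp add: combination_def scaleR_image_add body_def add_ac)

lemma mixed_combination:
  assumes "body A" "body B" "body C" "0 \<le> r" "0 \<le> s" "0 \<le> t" "0 \<le> r'" "0 \<le> s'" "0 \<le> t'"
  shows "mixed (combination A B C r s t) (combination A B C r' s' t') =
    r * r' * area A + s * s' * area B + t * t' * area C + (r * s' + s * r') * mixed A B
    + (r * t' + t * r') * mixed A C + (s * t' + t * s') * mixed B C"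
proof -
  have "2 * mixed (combination A B C r s t) (combination A B C r' s' t') =
    area (combination A B C (r + r') (s + s') (t + t'))
    - area (combination A B C r s t) - area (combination A B C r' s' t')"
    unfolding mixed_def using combination_add[OF assms] by simp
  also have "\<dots> = 2 * (r * r' * area A + s * s' * area B + t * t' * area C + (r * s' + s * r') * mixed A B
    + (r * t' + t * r') * mixed A C + (s * t' + t * s') * mixed B C)"
    using assms by (simp add: area_quadratic) algebra
  finally show ?thesis by simp
qed

text \<open>The Gram determinant of \<open>p\<close> and \<open>p + e x\<close> is \<open>e\<^sup>2\<close> times that of \<open>p\<close> and \<open>x\<close>. For \<open>p\<close> interior to the
  cone of nonnegative combinations, the former pair consists of bodies when \<open>e\<close> is small, so
  Minkowski's inequality holds for directions \<open>x\<close> of arbitrary sign; then \<open>p\<close> tends to \<open>A\<close>.\<close>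
lemma reversed_cauchy_schwarz:
  assumes bodies: "body A" "body B" "body C"
  shows "area A * (s\<^sup>2 * area B + t\<^sup>2 * area C + 2 * s * t * mixed B C)
    \<le> (s * mixed A B + t * mixed A C)\<^sup>2"
proof -
  define Q where "Q = (\<lambda>r s t. r\<^sup>2 * area A + s\<^sup>2 * area B + t\<^sup>2 * area C
    + 2 * r * s * mixed A B + 2 * r * t * mixed A C + 2 * s * t * mixed B C)"
  define V where "V = (\<lambda>r s t r' s' t'.
    r * r' * area A + s * s' * area B + t * t' * area C + (r * s' + s * r') * mixed A B
    + (r * t' + t * r') * mixed A C + (s * t' + t * s') * mixed B C)"
  have Q: "Q r s t * Q r' s' t' \<le> (V r s t r' s' t')\<^sup>2"
    if "0 \<le> r" "0 \<le> s" "0 \<le> t" "0 \<le> r'" "0 \<le> s'" "0 \<le> t'" for r s t r' s' t'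
  proof -
    define K L where "K = combination A B C r s t" and "L = combination A B C r' s' t'"
    have KL: "body K" "body L" using bodies by (auto simp: K_def L_def body_combination)
    have "area K * area L \<le> (mixed K L)\<^sup>2"
    \<comment> \<open>Minkowski's inequality was proved for positive areas; if one area is 0, the
      left side vanishes.\<close>
    proof (cases "area K = 0 \<or> area L = 0")
      case False
      then have "sqrt (area K * area L) \<le> mixed K L"
        using KL by (intro minkowski_first_inequality) (auto simp: less_le)
      then show ?thesis by (rule sqrt_le_D)
    qed auto
    then show ?thesis
      using bodies that by (simp add: K_def L_def Q_def V_def area_quadratic mixed_combination)
  qed
  have interior: "Q 1 d d * Q 0 s t \<le> (V 1 d d 0 s t)\<^sup>2" if "0 < d" for d
  proof -
    \<comment> \<open>Small enough that \<open>e * \<bar>s\<bar>\<close> and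
      \<open>e * \<bar>t\<bar>\<close> stay below \<open>d\<close>, which keeps the perturbed
      coefficients nonnegative. The summand 1 avoids division by zero.\<close>
    define e where "e = d / (1 + \<bar>s\<bar> + \<bar>t\<bar>)"
    have e: "0 < e" using \<open>0 < d\<close> by (simp add: e_def add_pos_nonneg)
    have ed: "e * (1 + \<bar>s\<bar> + \<bar>t\<bar>) = d" unfolding e_def by (simp add: add_pos_nonneg less_imp_neq[symmetric])
    have nn: "0 \<le> d + e * x" if "\<bar>x\<bar> \<le> 1 + \<bar>s\<bar> + \<bar>t\<bar>" for x
    proof -
      have "e * (- x) \<le> e * (1 + \<bar>s\<bar> + \<bar>t\<bar>)" using e that by (intro mult_left_mono) auto
      then show ?thesis using ed by simp
    qed
    have "0 \<le> (V 1 d d 1 (d + e * s) (d + e * t))\<^sup>2 - Q 1 d d * Q 1 (d + e * s) (d + e * t)"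
      using Q[of 1 d d 1 "d + e * s" "d + e * t"] nn[of s] nn[of t] \<open>0 < d\<close> by simp
    also have "\<dots> = e\<^sup>2 * ((V 1 d d 0 s t)\<^sup>2 - Q 1 d d * Q 0 s t)"
    proof -
      have "V 1 d d 1 (d + e * s) (d + e * t) = Q 1 d d + e * V 1 d d 0 s t"
        unfolding Q_def V_def by (simp add: power2_eq_square algebra_simps)
      moreover have "Q 1 (d + e * s) (d + e * t) = Q 1 d d + 2 * e * V 1 d d 0 s t + e\<^sup>2 * Q 0 s t"
        unfolding Q_def V_def by (simp add: power2_eq_square algebra_simps)
      ultimately show ?thesis by algebra
    qed
    finally have "0 \<le> (V 1 d d 0 s t)\<^sup>2 - Q 1 d d * Q 0 s t"
      using e by (simp add: zero_le_mult_iff)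
    then show ?thesis by simp
  qed
  have "Q 1 0 0 * Q 0 s t \<le> (V 1 0 0 0 s t)\<^sup>2"
  proof (rule tendsto_le)
    show "((\<lambda>d. Q 1 d d * Q 0 s t) \<longlongrightarrow> Q 1 0 0 * Q 0 s t) (at_right 0)"
      unfolding Q_def by (intro tendsto_intros)
    show "((\<lambda>d. (V 1 d d 0 s t)\<^sup>2) \<longlongrightarrow> (V 1 0 0 0 s t)\<^sup>2) (at_right 0)"
      unfolding V_def by (intro tendsto_intros)
    show "eventually (\<lambda>d. Q 1 d d * Q 0 s t \<le> (V 1 d d 0 s t)\<^sup>2) (at_right 0)"
      using interior by (auto simp: eventually_at_right_less intro: eventually_mono[OF eventually_at_right_less])
  qed simp
  then show ?thesis by (simp add: Q_def V_def)
qed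

section \<open>Inequalities between real numbers\<close>

lemma quadratic_form_discriminant:
  fixes p q r :: real
  assumes nonneg: "\<And>s t. 0 \<le> s\<^sup>2 * p + 2 * s * t * q + t\<^sup>2 * r"
  shows "q\<^sup>2 \<le> p * r"
proof (cases "p = 0")
  case True
  have "q = 0"
  proof (rule ccontr)
    assume "q \<noteq> 0"
    \<comment> \<open>With \<open>p = 0\<close> and \<open>t = 1\<close> the form is affine in
      \<open>s\<close>; this \<open>s\<close> gives it the value -1.\<close>
    then have "2 * (- (r + 1) / (2 * q)) * q = - (r + 1)" by simp
    then show False using nonneg[of "- (r + 1) / (2 * q)" 1] True by simp
  qed
  then show ?thesis using True by simp
next
  case False
  then have "0 < p" using nonneg[of 1 0] by simp
  \<comment> \<open>The value of the form at its minimiser in \<open>s\<close>, scaled to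
    \<open>s = - q\<close>, \<open>t = p\<close>.\<close>
  moreover have "0 \<le> p * (p * r - q\<^sup>2)"
    using nonneg[of "- q" p] by (simp add: power2_eq_square algebra_simps)
  ultimately show ?thesis by (simp add: zero_le_mult_iff)
qed

lemma sqrt_cauchy_schwarz:
  assumes "0 \<le> p" "0 \<le> q" "0 \<le> r" "0 \<le> s"
  shows "sqrt (p * r) + sqrt (q * s) \<le> sqrt ((p + q) * (r + s))"
proof (rule real_le_rsqrt)
  have "sqrt (p * r) * sqrt (q * s) = sqrt ((p * s) * (q * r))"
    by (simp add: ac_simps flip: real_sqrt_mult)
  also have "\<dots> \<le> (p * s + q * r) / 2"
    using assms by (intro arith_geo_mean_sqrt) auto
  finally have "2 * (sqrt (p * r) * sqrt (q * s)) \<le> p * s + q * r" by simp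
  then show "(sqrt (p * r) + sqrt (q * s))\<^sup>2 \<le> (p + q) * (r + s)"
    using assms by (simp add: power2_sum algebra_simps)
qed

lemma lorentzian_inequality:
  fixes a b c x y z :: real
  assumes "0 < a" "0 \<le> b" "0 \<le> c" "0 \<le> x" "0 \<le> y" and ab: "a * b \<le> x\<^sup>2" and ac: "a * c \<le> y\<^sup>2"
    and z: "(x * y - a * z)\<^sup>2 \<le> (x\<^sup>2 - a * b) * (y\<^sup>2 - a * c)"
  shows "sqrt a * sqrt (a + b + c + 2 * x + 2 * y + 2 * z) + sqrt b * sqrt c
    \<le> sqrt (a + b + 2 * x) * sqrt (a + c + 2 * y)"
proof -
  define p q where "p = sqrt (x\<^sup>2 - a * b)" and "q = sqrt (y\<^sup>2 - a * c)"
  have pq: "p\<^sup>2 = x\<^sup>2 - a * b" "q\<^sup>2 = y\<^sup>2 - a * c" "0 \<le> p" "0 \<le> q"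
    using ab ac by (auto simp: p_def q_def)
  have "p\<^sup>2 \<le> x\<^sup>2" "q\<^sup>2 \<le> y\<^sup>2" using pq(1,2) assms(1-3) by simp_all
  then have "p \<le> x" "q \<le> y" using assms(4,5) by (blast intro: power2_le_imp_le)+
  \<comment> \<open>null coordinates of \<open>B\<close> and \<open>C\<close>, scaled so that both coordinates of \<open>A\<close> are \<open>a\<close>\<close>
  define x1 x2 y1 y2 where "x1 = x + p" and "x2 = x - p" and "y1 = y + q" and "y2 = y - q"
  have nn: "0 \<le> x1" "0 \<le> x2" "0 \<le> y1" "0 \<le> y2"
    using pq assms \<open>p \<le> x\<close> \<open>q \<le> y\<close> by (auto simp: x1_def x2_def y1_def y2_def)
  have prods: "x1 * x2 = a * b" "y1 * y2 = a * c"
    using pq(1,2) by (auto simp: x1_def x2_def y1_def y2_def power2_eq_square algebra_simps)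
  have sums: "x1 + x2 = 2 * x" "y1 + y2 = 2 * y"
    by (auto simp: x1_def x2_def y1_def y2_def)
  have "(x * y - a * z)\<^sup>2 \<le> (p * q)\<^sup>2" using z pq by (simp add: power_mult_distrib)
  then have "\<bar>x * y - a * z\<bar> \<le> p * q" using pq by (simp add: abs_le_square_iff[symmetric])
  then have "2 * (a * z) \<le> 2 * (x * y + p * q)" using abs_le_D2 by fastforce
  also have "\<dots> = x1 * y1 + x2 * y2"
    by (simp add: x1_def x2_def y1_def y2_def algebra_simps)
  finally have az: "2 * (a * z) \<le> x1 * y1 + x2 * y2" .
  \<comment> \<open>The null coordinates of \<open>A + B + C\<close>, with \<open>C\<close> taken as
    \<open>(y2, y1)\<close>: this order realises the largest value of \<open>z\<close> that the
    bound above allows, and the form is then the product of the coordinates divided by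
    \<open>a\<close>.\<close>
  define U W where "U = a + x1 + y2" and "W = a + x2 + y1"
  have "a * (a + b + c + 2 * x + 2 * y + 2 * z)
      = a * a + a * b + a * c + a * (2 * x) + a * (2 * y) + 2 * (a * z)"
    by (simp add: algebra_simps)
  also have "\<dots> \<le> a * a + x1 * x2 + y1 * y2 + a * (x1 + x2) + a * (y1 + y2) + (x1 * y1 + x2 * y2)"
    using az unfolding prods sums by simp
  also have "\<dots> = U * W" by (simp add: U_def W_def algebra_simps)
  finally have F: "a * (a + b + c + 2 * x + 2 * y + 2 * z) \<le> U * W" .
  have "a * (sqrt a * sqrt (a + b + c + 2 * x + 2 * y + 2 * z) + sqrt b * sqrt c)
      = a * sqrt (a * (a + b + c + 2 * x + 2 * y + 2 * z)) + sqrt (a * a * (b * c))"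
    unfolding real_sqrt_mult real_sqrt_mult_self abs_of_pos[OF \<open>0 < a\<close>]
    by (rule distrib_left)
  also have "\<dots> \<le> a * sqrt (U * W) + sqrt (a * a * (b * c))"
    using F \<open>0 < a\<close> by simp
  also have "a * sqrt (U * W) = sqrt ((a * U) * (a * W))"
    using \<open>0 < a\<close> by (simp add: real_sqrt_mult)
  also have "a * a * (b * c) = (x1 * x2) * (y1 * y2)"
    unfolding prods by simp
  also have "(x1 * x2) * (y1 * y2) = (x1 * y2) * (x2 * y1)"
    by simp
  also have "sqrt ((a * U) * (a * W)) + sqrt ((x1 * y2) * (x2 * y1))
      \<le> sqrt ((a * U + x1 * y2) * (a * W + x2 * y1))"
    using nn \<open>0 < a\<close> by (intro sqrt_cauchy_schwarz) (auto simp: U_def W_def)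
  \<comment> \<open>The factors split as \<open>(a + x1) * (a + y2)\<close> and
    \<open>(a + x2) * (a + y1)\<close>. Regrouping these four by body yields \<open>A + B\<close>
    and \<open>A + C\<close>.\<close>
  also have "(a * U + x1 * y2) * (a * W + x2 * y1)
      = (a * a + a * (x1 + x2) + x1 * x2) * (a * a + a * (y1 + y2) + y1 * y2)"
    unfolding U_def W_def by algebra
  also have "\<dots> = (a * a) * ((a + b + 2 * x) * (a + c + 2 * y))"
    unfolding prods sums by algebra
  also have "sqrt \<dots> = a * (sqrt (a + b + 2 * x) * sqrt (a + c + 2 * y))"
    using \<open>0 < a\<close> by (simp add: real_sqrt_mult)
  finally show ?thesis using \<open>0 < a\<close> by simp
qed

lemma area_sqrt_inequality:
  assumes A: "body A" "0 < area A" and B: "body B" "0 < area B" and C: "body C" "0 < area C"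
  shows "sqrt (area A) * sqrt (area (A + B + C)) + sqrt (area B) * sqrt (area C)
    \<le> sqrt (area (A + B)) * sqrt (area (A + C))"
proof -
  note bodies = A(1) B(1) C(1)
  have m: "sqrt (area A * area B) \<le> mixed A B" "sqrt (area A * area C) \<le> mixed A C"
    using minkowski_first_inequality A B C by auto
  have "area (combination A B C 1 1 1) =
      area A + area B + area C + 2 * mixed A B + 2 * mixed A C + 2 * mixed B C"
    using area_quadratic[OF bodies, of 1 1 1] by simp
  then have ABC: "area (A + B + C) =
      area A + area B + area C + 2 * mixed A B + 2 * mixed A C + 2 * mixed B C"
    by (simp add: combination_def)
  have AB: "area (A + B) = area A + area B + 2 * mixed A B"
    and AC: "area (A + C) = area A + area C + 2 * mixed A C"
    by (simp_all add: mixed_def field_simps)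
  show ?thesis
    unfolding ABC AB AC
  proof (rule lorentzian_inequality)
    show "area A * area B \<le> (mixed A B)\<^sup>2" "area A * area C \<le> (mixed A C)\<^sup>2"
      using m by (auto intro: sqrt_le_D)
    show "0 \<le> mixed A B" "0 \<le> mixed A C"
      using m by (auto intro: order_trans[rotated])
    show "(mixed A B * mixed A C - area A * mixed B C)\<^sup>2
        \<le> ((mixed A B)\<^sup>2 - area A * area B) * ((mixed A C)\<^sup>2 - area A * area C)"
    \<comment> \<open>Right side minus left side of \<open>reversed_cauchy_schwarz\<close> is a
      nonnegative quadratic form in \<open>s\<close> and \<open>t\<close>, and the claim is its
      discriminant condition.\<close>
    proof (rule quadratic_form_discriminant)
      fix s t
      show "0 \<le> s\<^sup>2 * ((mixed A B)\<^sup>2 - area A * area B)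
          + 2 * s * t * (mixed A B * mixed A C - area A * mixed B C)
          + t\<^sup>2 * ((mixed A C)\<^sup>2 - area A * area C)"
        using reversed_cauchy_schwarz[OF bodies, of s t]
        by (simp add: power2_eq_square algebra_simps)
    qed
  qed (use A B C in auto)
qed

section \<open>Transfer to vectors of length two\<close>

text \<open>Slicing is carried out in a product of two lines; this linear bijection moves the result
  to the plane of the theorem.\<close>

definition vec2_pair :: "real ^ 2 \<Rightarrow> real \<times> real" where
  "vec2_pair v = (v $ 1, v $ 2)"

lemma linear_vec2_pair: "linear vec2_pair"
  by (rule linearI) (auto simp: vec2_pair_def)

lemma inj_vec2_pair: "inj vec2_pair"
  by (rule injI) (simp add: vec2_pair_def vec_eq_iff forall_2)

text \<open>Lebesgue measure is determined by its values on boxes, and the preimage of a box is the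
  box with the same side lengths.\<close>

lemma distr_vec2_pair: "distr lborel borel vec2_pair = lborel"
proof (rule lborel_eqI[symmetric])
  have meas: "vec2_pair \<in> borel_measurable borel"
    using linear_vec2_pair
    by (intro borel_measurable_continuous_onI linear_continuous_on) (simp add: linear_conv_bounded_linear)
  fix l u :: "real \<times> real"
  assume le: "\<And>b. b \<in> Basis \<Longrightarrow> l \<bullet> b \<le> u \<bullet> b"
  obtain l1 l2 u1 u2 where lu: "l = (l1, l2)" "u = (u1, u2)" by fastforce
  have "l1 \<le> u1" "l2 \<le> u2"
    using le[of "(1, 0)"] le[of "(0, 1)"] by (auto simp: lu Basis_prod_def)
  define l' u' :: "real ^ 2" where "l' = vector [l1, l2]" and "u' = vector [u1, u2]"
  have "vec2_pair -` box l u = box l' u'"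
    by (auto simp: vec2_pair_def lu box_def Basis_prod_def Basis_vec_def UNIV_2 l'_def u'_def inner_axis)
  then have "emeasure (distr lborel borel vec2_pair) (box l u) = emeasure lborel (box l' u')"
    using meas by (simp add: emeasure_distr)
  also have "\<dots> = (\<Prod>b\<in>Basis. (u' - l') \<bullet> b)"
    using \<open>l1 \<le> u1\<close> \<open>l2 \<le> u2\<close>
    by (intro emeasure_lborel_box) (auto simp: Basis_vec_def UNIV_2 l'_def u'_def inner_axis)
  also have "(\<Prod>b\<in>Basis. (u' - l') \<bullet> b) = (\<Prod>b\<in>Basis. (u - l) \<bullet> b)"
  proof -
    have vec: "Basis = {axis 1 1, axis 2 1 :: real ^ 2}" and pair: "Basis = {(1, 0), (0, 1) :: real \<times> real}"
      by (auto simp: Basis_vec_def UNIV_2 Basis_prod_def)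
    have "axis 1 1 \<noteq> (axis 2 1 :: real ^ 2)" by (simp add: axis_eq_axis)
    then show ?thesis unfolding vec pair by (simp add: lu l'_def u'_def inner_axis)
  qed
  finally show "emeasure (distr lborel borel vec2_pair) (box l u) = (\<Prod>b\<in>Basis. (u - l) \<bullet> b)" .
qed simp

lemma measure_vec2_pair:
  assumes "compact K"
  shows "measure lebesgue K = area (vec2_pair ` K)"
proof -
  have cont: "continuous_on S vec2_pair" for S
    using linear_vec2_pair by (intro linear_continuous_on) (simp add: linear_conv_bounded_linear)
  have "compact (vec2_pair ` K)" using assms by (intro compact_continuous_image cont)
  then have "vec2_pair ` K \<in> sets borel" by (rule borel_compact)
  then have "measure (distr lborel borel vec2_pair) (vec2_pair ` K)
      = measure lborel (vec2_pair -` (vec2_pair ` K))"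
    using cont by (subst measure_distr) (auto intro: borel_measurable_continuous_onI)
  also have "vec2_pair -` (vec2_pair ` K) = K" by (rule inj_vimage_image_eq[OF inj_vec2_pair])
  also have "measure lborel K = measure lebesgue K" using assms by (simp add: borel_compact)
  finally show ?thesis by (simp add: distr_vec2_pair)
qed

text \<open>A non-empty interior makes the set non-negligible, which is the source of the positive
  areas assumed in the planar argument.\<close>

lemma convex_body_vec2_pair:
  assumes "convex_body K"
  shows "body (vec2_pair ` K)" "0 < area (vec2_pair ` K)"
proof -
  have K: "convex K" "compact K" "interior K \<noteq> {}" using assms by (auto simp: convex_body_def)
  then have "body K" using interior_subset by (fastforce simp: body_def)
  then show "body (vec2_pair ` K)" by (rule body_linear_image[OF linear_vec2_pair])
  have "\<not> negligible K"
    using K(3) open_not_negligible[of "interior K"] negligible_subset interior_subset by blast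
  then have "measure lebesgue K \<noteq> 0"
    using K(2) by (simp add: negligible_iff_measure lmeasurable_compact)
  then show "0 < area (vec2_pair ` K)"
    using measure_vec2_pair[OF K(2)] by (simp add: less_le)
qed

theorem theorem4p1:
  fixes A B C :: "(real ^ 2) set"
  assumes "convex_body A" and "convex_body B" and "convex_body C"
  shows "sqrt (measure lebesgue A) * sqrt (measure lebesgue (A + B + C))
       + sqrt (measure lebesgue B) * sqrt (measure lebesgue C)
       \<le> sqrt (measure lebesgue (A + B)) * sqrt (measure lebesgue (A + C))"
proof -
  have "body A" "body B" "body C"
    using assms interior_subset by (fastforce simp: convex_body_def body_def)+
  then have "compact A" "compact B" "compact C" "compact (A + B)" "compact (A + C)" "compact (A + B + C)"
    using body_plus unfolding body_def by auto
  then show ?thesis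
    using area_sqrt_inequality[OF convex_body_vec2_pair[OF assms(1)]
        convex_body_vec2_pair[OF assms(2)] convex_body_vec2_pair[OF assms(3)]]
    by (simp add: measure_vec2_pair linear_image_plus[OF linear_vec2_pair])
qed

end
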